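(* Let $U\subseteq\mathbb R^2$ be a nonempty connected open set with coordinates $(x,u)$, let $\phi\in\mathcal C^\infty(U)$, and consider the first-order ODE $u'(x)=\phi(x,u)$, with associated vector field $A=\partial_x+\phi\,\partial_u$ and associated surface $\mathcal S=(U,g)$. Suppose that the Gaussian curvature of $\mathcal S$ depends only on $x$: $\mathcal K(x,u)=k(x)$ on $U$, where $k$ is a smooth function on the open interval $I=\{x:(x,u)\in U\text{ for some }u\}$. Let $\delta\in\mathcal C^\infty(I)$ be a solution, not identically zero, of the Schrödinger-type equation $$\ddot\delta(x)+k(x)\delta(x)=0 .$$ Then $J=\delta(x)\,\partial_u$ is a Jacobi field relative to $A$. Consequently, with $\mathfrak S(\delta)=A(\delta)-\phi_u\delta$: if $\mathfrak S(\delta)=0$ on $U$, then every point at which $\delta\ne0$ has an open neighbourhood on which $\delta^{-1}$ is an integrating factor for $-\phi\,dx+du\equiv0$; and if $\mathfrak S(\delta)$ is not identically zero on $U$, then every point at which $\mathfrak S(\delta)\neq0$ has an open neighbourhood on which $\mathfrak S(\delta)$ is an integrating factor for $-\phi\,dx+du\equiv0$.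
   Context: Subscripts denote partial derivatives, dots denote $d/dx$, vector fields act on functions as derivations, and a function of $x$ alone is also regarded as a function on $U$. Integrating factor: on an open set $V\subseteq U$, a non-vanishing $\mu\in\mathcal C^\infty(V)$ is an integrating factor for $-\phi\,dx+du\equiv0$ if there exists $F\in\mathcal C^\infty(V)$ with $dF=\mu(-\phi\,dx+du)$. Associated surface: $\mathcal S=(U,g)$, where $g$ is the Riemannian metric whose matrix in the coordinates $(x,u)$ is $\begin{pmatrix}1+\phi^2&-\phi\\-\phi&1\end{pmatrix}$. The vector fields $A$ and $\partial_u$ form an orthonormal frame for $g$. Let $\nabla$ be the Levi-Civita connection of $g$. For $X=x_1A+x_2\partial_u$ and $Y=y_1A+y_2\partial_u$ it is given by $\nabla_XY=(X(y_1)-\phi_u x_2y_2)A+(X(y_2)+\phi_u x_2y_1)\partial_u$. The vector field $A$ is geodesic, i.e. $\nabla_AA=0$. The Gaussian curvature of $\mathcal S$ is $\mathcal K=-\partial_u(A(\phi))$. Jacobi field relative to $A$: a smooth vector field $J$ on $U$ such that $\nabla_A\nabla_AJ+\mathcal K\,(g(A,A)J-g(J,A)A)=0$, where $g(A,A)=1$. *)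

theory Defs
  imports "HOL-Analysis.Analysis"
begin

section \<open>Smooth functions\<close>

text \<open>
  All sets \<^term>\<open>S\<close> below are open; functions are total and their values outside of
  \<^term>\<open>S\<close> are irrelevant.
\<close>

primrec k_smooth_on ::
  "nat \<Rightarrow> 'a::real_normed_vector set \<Rightarrow> ('a \<Rightarrow> 'b::real_normed_vector) \<Rightarrow> bool" where
  "k_smooth_on 0 S f = continuous_on S f"
| "k_smooth_on (Suc n) S f =
     ((\<forall>x\<in>S. f differentiable (at x)) \<and>
      (\<forall>v. k_smooth_on n S (\<lambda>x. frechet_derivative f (at x) v)))"

definition smooth_on ::
  "'a::real_normed_vector set \<Rightarrow> ('a \<Rightarrow> 'b::real_normed_vector) \<Rightarrow> bool" where
  "smooth_on S f \<longleftrightarrow> (\<forall>n. k_smooth_on n S f)"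

section \<open>Vector fields, connections and curvature on open subsets of the plane\<close>

type_synonym plane = "real \<times> real"
type_synonym vfield = "plane \<Rightarrow> plane"
type_synonym metric = "plane \<Rightarrow> plane \<Rightarrow> plane \<Rightarrow> real"
type_synonym connection = "vfield \<Rightarrow> vfield \<Rightarrow> vfield"

definition vf_app :: "vfield \<Rightarrow> (plane \<Rightarrow> 'b::real_normed_vector) \<Rightarrow> plane \<Rightarrow> 'b" where
  "vf_app X f p = frechet_derivative f (at p) (X p)"

definition dx :: vfield where "dx p = (1, 0)"
definition du :: vfield where "du p = (0, 1)"

text \<open>In coordinates, the components of \<^term>\<open>vf_app X Y\<close> are \<open>X(Y\<^sub>1)\<close> and \<open>X(Y\<^sub>2)\<close>.\<close>

definition lie_bracket :: "vfield \<Rightarrow> vfield \<Rightarrow> vfield" where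
  "lie_bracket X Y p = vf_app X Y p - vf_app Y X p"

definition affine_connection :: "plane set \<Rightarrow> connection \<Rightarrow> bool" where
  "affine_connection U D \<longleftrightarrow>
     (\<forall>X Y. smooth_on U X \<longrightarrow> smooth_on U Y \<longrightarrow> smooth_on U (D X Y)) \<and>
     (\<forall>X Y Z. smooth_on U X \<longrightarrow> smooth_on U Y \<longrightarrow> smooth_on U Z \<longrightarrow>
        (\<forall>p\<in>U. D (\<lambda>q. X q + Y q) Z p = D X Z p + D Y Z p \<and>
                D X (\<lambda>q. Y q + Z q) p = D X Y p + D X Z p)) \<and>
     (\<forall>f X Y. smooth_on U f \<longrightarrow> smooth_on U X \<longrightarrow> smooth_on U Y \<longrightarrow>
        (\<forall>p\<in>U. D (\<lambda>q. f q *\<^sub>R X q) Y p = f p *\<^sub>R D X Y p \<and>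
                D X (\<lambda>q. f q *\<^sub>R Y q) p = f p *\<^sub>R D X Y p + vf_app X f p *\<^sub>R Y p))"

definition torsion_free :: "plane set \<Rightarrow> connection \<Rightarrow> bool" where
  "torsion_free U D \<longleftrightarrow>
     (\<forall>X Y. smooth_on U X \<longrightarrow> smooth_on U Y \<longrightarrow>
        (\<forall>p\<in>U. D X Y p - D Y X p = lie_bracket X Y p))"

definition metric_compatible :: "plane set \<Rightarrow> metric \<Rightarrow> connection \<Rightarrow> bool" where
  "metric_compatible U g D \<longleftrightarrow>
     (\<forall>X Y Z. smooth_on U X \<longrightarrow> smooth_on U Y \<longrightarrow> smooth_on U Z \<longrightarrow>
        (\<forall>p\<in>U. vf_app X (\<lambda>q. g q (Y q) (Z q)) p = g p (D X Y p) (Z p) + g p (Y p) (D X Z p)))"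

definition levi_civita :: "plane set \<Rightarrow> metric \<Rightarrow> connection \<Rightarrow> bool" where
  "levi_civita U g D \<longleftrightarrow>
     affine_connection U D \<and> torsion_free U D \<and> metric_compatible U g D"

definition curvature :: "connection \<Rightarrow> vfield \<Rightarrow> vfield \<Rightarrow> vfield \<Rightarrow> vfield" where
  "curvature D X Y Z p = D X (D Y Z) p - D Y (D X Z) p - D (lie_bracket X Y) Z p"

definition gaussian_curvature :: "metric \<Rightarrow> connection \<Rightarrow> plane \<Rightarrow> real" where
  "gaussian_curvature g D p =
     g p (curvature D dx du du p) (dx p) /
     (g p (dx p) (dx p) * g p (du p) (du p) - (g p (dx p) (du p))\<^sup>2)"

text \<open>
  Here \<^term>\<open>A\<close> is a geodesic unit vector field and \<^term>\<open>D\<close> the Levi-Civita connection of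
  \<^term>\<open>g\<close>.
\<close>

definition jacobi_field :: "plane set \<Rightarrow> metric \<Rightarrow> connection \<Rightarrow> vfield \<Rightarrow> vfield \<Rightarrow> bool" where
  "jacobi_field U g D A J \<longleftrightarrow>
     smooth_on U J \<and>
     (\<forall>p\<in>U. D A (D A J) p
        + gaussian_curvature g D p *\<^sub>R (g p (A p) (A p) *\<^sub>R J p - g p (J p) (A p) *\<^sub>R A p) = 0)"

section \<open>The ODE \<open>u' = \<phi>(x, u)\<close>\<close>

definition ode_field :: "(plane \<Rightarrow> real) \<Rightarrow> vfield" where
  "ode_field \<phi> p = dx p + \<phi> p *\<^sub>R du p"

definition surface_metric :: "(plane \<Rightarrow> real) \<Rightarrow> metric" where
  "surface_metric \<phi> p v w =
     (1 + (\<phi> p)\<^sup>2) * fst v * fst w - \<phi> p * fst v * snd w - \<phi> p * snd v * fst w + snd v * snd w"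

definition frak_S :: "(plane \<Rightarrow> real) \<Rightarrow> (plane \<Rightarrow> real) \<Rightarrow> plane \<Rightarrow> real" where
  "frak_S \<phi> f p = vf_app (ode_field \<phi>) f p - vf_app du \<phi> p * f p"

definition integrating_factor :: "(plane \<Rightarrow> real) \<Rightarrow> plane set \<Rightarrow> (plane \<Rightarrow> real) \<Rightarrow> bool" where
  "integrating_factor \<phi> V \<mu> \<longleftrightarrow>
     smooth_on V \<mu> \<and> (\<forall>p\<in>V. \<mu> p \<noteq> 0) \<and>
     (\<exists>F. smooth_on V F \<and>
        (\<forall>p\<in>V. (F has_derivative (\<lambda>v. \<mu> p * (- \<phi> p * fst v + snd v))) (at p)))"

section \<open>Existence of the Levi-Civita connection\<close>

text \<open>
  The predicate \<^const>\<open>levi_civita\<close> is satisfiable for \<^const>\<open>surface_metric\<close>: it holds of the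
  connection given in the frame \<open>A, \<partial>\<^sub>u\<close> by the explicit formula \<open>surface_connection\<close>.
\<close>

definition fr1 :: "vfield \<Rightarrow> plane \<Rightarrow> real" where
  "fr1 X p = fst (X p)"
definition fr2 :: "(plane \<Rightarrow> real) \<Rightarrow> vfield \<Rightarrow> plane \<Rightarrow> real" where
  "fr2 \<phi> X p = snd (X p) - \<phi> p * fst (X p)"

definition surface_connection :: "(plane \<Rightarrow> real) \<Rightarrow> connection" where
  "surface_connection \<phi> X Y p =
     (vf_app X (fr1 Y) p - vf_app du \<phi> p * fr2 \<phi> X p * fr2 \<phi> Y p) *\<^sub>R ode_field \<phi> p
     + (vf_app X (fr2 \<phi> Y) p + vf_app du \<phi> p * fr2 \<phi> X p * fr1 Y p) *\<^sub>R du p"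

lemma k_smooth_on_cong:
  assumes "open S" "\<And>x. x \<in> S \<Longrightarrow> f x = g x" "k_smooth_on n S f"
  shows "k_smooth_on n S g"
  using assms(2,3)
proof (induction n arbitrary: f g)
  case 0
  then show ?case using continuous_on_cong[of S S f g] by simp
next
  case (Suc n)
  have d: "(g has_derivative frechet_derivative f (at x)) (at x)" if "x \<in> S" for x
  proof -
    have "(f has_derivative frechet_derivative f (at x)) (at x)"
      using Suc.prems(2) that by (simp add: frechet_derivative_works)
    then show ?thesis
      using has_derivative_transform_within_open[OF _ assms(1) that] Suc.prems(1) by blast
  qed
  have e: "frechet_derivative f (at x) v = frechet_derivative g (at x) v" if "x \<in> S" for x v
    using frechet_derivative_at[OF d[OF that]] by simp
  have "k_smooth_on n S (\<lambda>x. frechet_derivative g (at x) v)" for v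
    by (rule Suc.IH[where f = "\<lambda>x. frechet_derivative f (at x) v"]) (use e Suc.prems in auto)
  moreover have "\<forall>x\<in>S. g differentiable (at x)"
    using d differentiableI by blast
  ultimately show ?case by simp
qed

lemma k_smooth_on_SucD: "k_smooth_on (Suc n) S f \<Longrightarrow> k_smooth_on n S f"
proof (induction n arbitrary: f)
  case 0
  then have "f differentiable_on S"
    by (simp add: differentiable_at_imp_differentiable_on)
  then show ?case by (simp add: differentiable_imp_continuous_on)
next
  case (Suc n)
  then show ?case by (metis k_smooth_on.simps(2))
qed

lemma k_smooth_on_const: "k_smooth_on n S (\<lambda>x. c)"
  by (induction n arbitrary: c) auto

lemma k_smooth_on_add:
  assumes "open S" "k_smooth_on n S f" "k_smooth_on n S g"
  shows "k_smooth_on n S (\<lambda>x. f x + g x)"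
  using assms(2,3)
proof (induction n arbitrary: f g)
  case 0
  then show ?case by (simp add: continuous_on_add)
next
  case (Suc n)
  have d: "((\<lambda>x. f x + g x) has_derivative
      (\<lambda>v. frechet_derivative f (at x) v + frechet_derivative g (at x) v)) (at x)"
    if "x \<in> S" for x
    by (rule has_derivative_add) (use Suc.prems that in \<open>simp_all add: frechet_derivative_works\<close>)
  have e: "frechet_derivative f (at x) v + frechet_derivative g (at x) v
      = frechet_derivative (\<lambda>x. f x + g x) (at x) v" if "x \<in> S" for x v
    by (rule fun_cong[OF frechet_derivative_at[OF d[OF that]]])
  have "k_smooth_on n S (\<lambda>x. frechet_derivative (\<lambda>x. f x + g x) (at x) v)" for v
    by (rule k_smooth_on_cong[OF assms(1) e]) (use Suc in auto)
  moreover have "\<forall>x\<in>S. (\<lambda>x. f x + g x) differentiable (at x)"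
    using d differentiableI by blast
  ultimately show ?case by simp
qed

lemma (in bounded_bilinear) k_smooth_on_prod:
  assumes "open S" "k_smooth_on n S f" "k_smooth_on n S g"
  shows "k_smooth_on n S (\<lambda>x. prod (f x) (g x))"
  using assms(2,3)
proof (induction n arbitrary: f g)
  case 0
  then show ?case by (simp add: continuous_on)
next
  case (Suc n)
  have d: "((\<lambda>x. prod (f x) (g x)) has_derivative
      (\<lambda>v. prod (f x) (frechet_derivative g (at x) v) + prod (frechet_derivative f (at x) v) (g x))) (at x)"
    if "x \<in> S" for x
    using FDERIV[of f "frechet_derivative f (at x)" x UNIV g "frechet_derivative g (at x)"]
      Suc.prems that by (simp add: frechet_derivative_works)
  have e: "prod (f x) (frechet_derivative g (at x) v) + prod (frechet_derivative f (at x) v) (g x)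
      = frechet_derivative (\<lambda>x. prod (f x) (g x)) (at x) v" if "x \<in> S" for x v
    by (rule fun_cong[OF frechet_derivative_at[OF d[OF that]]])
  have f: "k_smooth_on n S f" "k_smooth_on n S g"
    using Suc.prems k_smooth_on_SucD by blast+
  have "k_smooth_on n S (\<lambda>x. frechet_derivative (\<lambda>x. prod (f x) (g x)) (at x) v)" for v
    by (rule k_smooth_on_cong[OF assms(1) e], assumption, rule k_smooth_on_add[OF assms(1)])
       (use Suc f in auto)
  moreover have "\<forall>x\<in>S. (\<lambda>x. prod (f x) (g x)) differentiable (at x)"
    using d differentiableI by blast
  ultimately show ?case by simp
qed

lemma k_smooth_on_linear:
  assumes "bounded_linear h" "open S" "k_smooth_on n S f"
  shows "k_smooth_on n S (\<lambda>x. h (f x))"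
  using assms(3)
proof (induction n arbitrary: f)
  case 0
  then show ?case using bounded_linear.continuous_on[OF assms(1)] by simp
next
  case (Suc n)
  have d: "((\<lambda>x. h (f x)) has_derivative (\<lambda>v. h (frechet_derivative f (at x) v))) (at x)"
    if "x \<in> S" for x
    by (rule bounded_linear.has_derivative[OF assms(1)])
       (use Suc.prems that in \<open>simp add: frechet_derivative_works\<close>)
  have e: "h (frechet_derivative f (at x) v) = frechet_derivative (\<lambda>x. h (f x)) (at x) v"
    if "x \<in> S" for x v
    by (rule fun_cong[OF frechet_derivative_at[OF d[OF that]]])
  have "k_smooth_on n S (\<lambda>x. frechet_derivative (\<lambda>x. h (f x)) (at x) v)" for v
    by (rule k_smooth_on_cong[OF assms(2) e]) (use Suc in auto)
  moreover have "\<forall>x\<in>S. (\<lambda>x. h (f x)) differentiable (at x)"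
    using d differentiableI by blast
  ultimately show ?case by simp
qed

lemma smooth_on_const: "smooth_on S (\<lambda>x. c)"
  by (simp add: smooth_on_def k_smooth_on_const)

lemma smooth_on_add:
  "open S \<Longrightarrow> smooth_on S f \<Longrightarrow> smooth_on S g \<Longrightarrow> smooth_on S (\<lambda>x. f x + g x)"
  by (simp add: smooth_on_def k_smooth_on_add)

lemma smooth_on_scaleR:
  "open S \<Longrightarrow> smooth_on S f \<Longrightarrow> smooth_on S g \<Longrightarrow> smooth_on S (\<lambda>x. f x *\<^sub>R g x)"
  by (simp add: smooth_on_def bounded_bilinear.k_smooth_on_prod[OF bounded_bilinear_scaleR])

lemma smooth_on_mult:
  fixes f g :: "'a::real_normed_vector \<Rightarrow> real"
  shows "open S \<Longrightarrow> smooth_on S f \<Longrightarrow> smooth_on S g \<Longrightarrow> smooth_on S (\<lambda>x. f x * g x)"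
  using smooth_on_scaleR[of S f g] by simp

lemma smooth_on_linear:
  "bounded_linear h \<Longrightarrow> open S \<Longrightarrow> smooth_on S f \<Longrightarrow> smooth_on S (\<lambda>x. h (f x))"
  by (simp add: smooth_on_def k_smooth_on_linear)

lemma smooth_on_diff:
  assumes "open S" "smooth_on S f" "smooth_on S g"
  shows "smooth_on S (\<lambda>x. f x - g x)"
proof -
  have "smooth_on S (\<lambda>x. - g x)"
    by (rule smooth_on_linear[OF bounded_linear_minus[OF bounded_linear_ident] assms(1,3)])
  then show ?thesis using smooth_on_add[OF assms(1,2), of "\<lambda>x. - g x"] by simp
qed

lemma smooth_on_cong:
  "open S \<Longrightarrow> (\<And>x. x \<in> S \<Longrightarrow> f x = g x) \<Longrightarrow> smooth_on S f \<Longrightarrow> smooth_on S g"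
  using k_smooth_on_cong unfolding smooth_on_def by blast

lemma smooth_on_deriv:
  assumes "smooth_on S f"
  shows "smooth_on S (\<lambda>x. frechet_derivative f (at x) v)"
  unfolding smooth_on_def
proof
  fix n
  have "k_smooth_on (Suc n) S f" using assms unfolding smooth_on_def by blast
  then show "k_smooth_on n S (\<lambda>x. frechet_derivative f (at x) v)" by simp
qed

lemma smooth_on_has_derivative:
  assumes "smooth_on S f" "x \<in> S"
  shows "(f has_derivative frechet_derivative f (at x)) (at x)"
proof -
  have "k_smooth_on (Suc 0) S f" using assms(1) unfolding smooth_on_def by blast
  then show ?thesis using assms(2) by (simp add: frechet_derivative_works)
qed

lemma smooth_on_vf_app:
  assumes "open U" "smooth_on U X" "smooth_on U f"
  shows "smooth_on U (vf_app X f)"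
proof -
  define h where "h p = fst (X p) *\<^sub>R frechet_derivative f (at p) (1, 0)
      + snd (X p) *\<^sub>R frechet_derivative f (at p) (0, 1)" for p
  have "smooth_on U h"
    unfolding h_def[abs_def]
    by (rule smooth_on_add[OF assms(1)]; rule smooth_on_scaleR[OF assms(1)])
       (rule smooth_on_linear[OF bounded_linear_fst assms(1,2)]
             smooth_on_linear[OF bounded_linear_snd assms(1,2)]
             smooth_on_deriv[OF assms(3)])+
  moreover have "h p = vf_app X f p" if "p \<in> U" for p
  proof -
    interpret bounded_linear "frechet_derivative f (at p)"
      by (rule has_derivative_bounded_linear[OF smooth_on_has_derivative[OF assms(3) that]])
    have "h p = frechet_derivative f (at p) (fst (X p) *\<^sub>R (1, 0) + snd (X p) *\<^sub>R (0, 1))"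
      by (simp only: add scaleR h_def)
    then show ?thesis by (simp add: vf_app_def)
  qed
  ultimately show ?thesis by (rule smooth_on_cong[OF assms(1), rotated])
qed

lemma vf_app_eqI: "(f has_derivative f') (at p) \<Longrightarrow> vf_app X f p = f' (X p)"
  unfolding vf_app_def using frechet_derivative_at by metis

lemma vf_app_add:
  "smooth_on U f \<Longrightarrow> smooth_on U g \<Longrightarrow> p \<in> U \<Longrightarrow>
     vf_app X (\<lambda>q. f q + g q) p = vf_app X f p + vf_app X g p"
  using vf_app_eqI[OF has_derivative_add[OF smooth_on_has_derivative smooth_on_has_derivative],
      of U f p U g X]
  by (simp add: vf_app_def)

lemma vf_app_diff:
  "smooth_on U f \<Longrightarrow> smooth_on U g \<Longrightarrow> p \<in> U \<Longrightarrow>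
     vf_app X (\<lambda>q. f q - g q) p = vf_app X f p - vf_app X g p"
  using vf_app_eqI[OF has_derivative_diff[OF smooth_on_has_derivative smooth_on_has_derivative],
      of U f p U g X]
  by (simp add: vf_app_def)

lemma vf_app_mult:
  fixes f g :: "plane \<Rightarrow> real"
  shows "smooth_on U f \<Longrightarrow> smooth_on U g \<Longrightarrow> p \<in> U \<Longrightarrow>
     vf_app X (\<lambda>q. f q * g q) p = f p * vf_app X g p + vf_app X f p * g p"
  using vf_app_eqI[OF has_derivative_mult[OF smooth_on_has_derivative smooth_on_has_derivative],
      of U f p U g X]
  by (simp add: vf_app_def)

lemma vf_app_linear:
  "bounded_linear h \<Longrightarrow> smooth_on U f \<Longrightarrow> p \<in> U \<Longrightarrow>
     vf_app X (\<lambda>q. h (f q)) p = h (vf_app X f p)"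
  using vf_app_eqI[OF bounded_linear.has_derivative[OF _ smooth_on_has_derivative], of h U f p X]
  by (simp add: vf_app_def)

lemma vf_app_field_linear:
  assumes "smooth_on U f" "p \<in> U"
  shows "vf_app (\<lambda>q. X q + Y q) f p = vf_app X f p + vf_app Y f p"
    and "vf_app (\<lambda>q. c q *\<^sub>R X q) f p = c p *\<^sub>R vf_app X f p"
proof -
  interpret bounded_linear "frechet_derivative f (at p)"
    by (rule has_derivative_bounded_linear[OF smooth_on_has_derivative[OF assms]])
  show "vf_app (\<lambda>q. X q + Y q) f p = vf_app X f p + vf_app Y f p"
    and "vf_app (\<lambda>q. c q *\<^sub>R X q) f p = c p *\<^sub>R vf_app X f p"
    by (simp_all add: vf_app_def add scaleR)
qed

lemma vf_app_coords:
  assumes "smooth_on U f" "p \<in> U"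
  shows "vf_app X f p = fst (X p) *\<^sub>R vf_app dx f p + snd (X p) *\<^sub>R vf_app du f p"
proof -
  interpret bounded_linear "frechet_derivative f (at p)"
    by (rule has_derivative_bounded_linear[OF smooth_on_has_derivative[OF assms]])
  have "frechet_derivative f (at p) (fst (X p) *\<^sub>R (1, 0) + snd (X p) *\<^sub>R (0, 1))
      = fst (X p) *\<^sub>R frechet_derivative f (at p) (1, 0)
        + snd (X p) *\<^sub>R frechet_derivative f (at p) (0, 1)"
    by (simp only: add scaleR)
  then show ?thesis by (simp add: vf_app_def dx_def du_def)
qed

lemma smooth_on_fr:
  assumes "open U" "smooth_on U \<phi>" "smooth_on U X"
  shows "smooth_on U (\<lambda>p. fst (X p))" "smooth_on U (\<lambda>p. snd (X p))"
    "smooth_on U (fr1 X)" "smooth_on U (fr2 \<phi> X)"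
proof -
  show 1: "smooth_on U (\<lambda>p. fst (X p))" "smooth_on U (\<lambda>p. snd (X p))"
    by (intro assms smooth_on_linear[OF bounded_linear_fst] smooth_on_linear[OF bounded_linear_snd])+
  show "smooth_on U (fr1 X)" "smooth_on U (fr2 \<phi> X)"
    unfolding fr1_def[abs_def] fr2_def[abs_def]
    by (intro 1 smooth_on_diff smooth_on_mult assms)+
qed

lemma smooth_on_frame:
  assumes "open U" "smooth_on U \<phi>"
  shows "smooth_on U dx" "smooth_on U du" "smooth_on U (ode_field \<phi>)"
proof -
  show 1: "smooth_on U dx" "smooth_on U du"
    unfolding dx_def[abs_def] du_def[abs_def] by (rule smooth_on_const)+
  show "smooth_on U (ode_field \<phi>)"
    unfolding ode_field_def[abs_def] by (intro smooth_on_add smooth_on_scaleR assms 1)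
qed

lemma surface_metric_frame:
  "surface_metric \<phi> p (X p) (Y p) = fr1 X p * fr1 Y p + fr2 \<phi> X p * fr2 \<phi> Y p"
  by (simp add: surface_metric_def fr1_def fr2_def algebra_simps power2_eq_square)

lemma surface_connection_levi_civita:
  assumes U: "open U" and phi: "smooth_on U \<phi>"
  shows "levi_civita U (surface_metric \<phi>) (surface_connection \<phi>)"
proof -
  note sm = smooth_on_fr[OF U phi] smooth_on_frame[OF U phi] smooth_on_vf_app[OF U]
  have fr1_C: "fr1 (surface_connection \<phi> X Y) p =
      vf_app X (fr1 Y) p - vf_app du \<phi> p * fr2 \<phi> X p * fr2 \<phi> Y p"
    and fr2_C: "fr2 \<phi> (surface_connection \<phi> X Y) p =
      vf_app X (fr2 \<phi> Y) p + vf_app du \<phi> p * fr2 \<phi> X p * fr1 Y p" for X Y p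
    unfolding surface_connection_def fr1_def[of "surface_connection \<phi> X Y"]
      fr2_def[of \<phi> "surface_connection \<phi> X Y"]
    by (simp_all add: ode_field_def dx_def du_def algebra_simps)
  have a1: "smooth_on U (surface_connection \<phi> X Y)" if "smooth_on U X" "smooth_on U Y" for X Y
    unfolding surface_connection_def[abs_def]
    by (intro smooth_on_add smooth_on_diff smooth_on_scaleR smooth_on_mult sm U phi that)
  have fr_add: "fr1 (\<lambda>q. X q + Y q) = (\<lambda>q. fr1 X q + fr1 Y q)"
      "fr2 \<phi> (\<lambda>q. X q + Y q) = (\<lambda>q. fr2 \<phi> X q + fr2 \<phi> Y q)" for X Y
    by (auto simp: fr1_def fr2_def algebra_simps)
  have fr_scale: "fr1 (\<lambda>q. f q *\<^sub>R Y q) = (\<lambda>q. f q * fr1 Y q)"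
      "fr2 \<phi> (\<lambda>q. f q *\<^sub>R Y q) = (\<lambda>q. f q * fr2 \<phi> Y q)" for f Y
    by (auto simp: fr1_def fr2_def algebra_simps)
  have a2: "surface_connection \<phi> (\<lambda>q. X q + Y q) Z p
        = surface_connection \<phi> X Z p + surface_connection \<phi> Y Z p"
    and a3: "surface_connection \<phi> X (\<lambda>q. Y q + Z q) p
        = surface_connection \<phi> X Y p + surface_connection \<phi> X Z p"
    if "smooth_on U X" "smooth_on U Y" "smooth_on U Z" "p \<in> U" for X Y Z p
    using that
    by (simp_all add: surface_connection_def fr_add vf_app_field_linear[OF sm(3)]
        vf_app_field_linear[OF sm(4)] vf_app_add[OF sm(3) sm(3)] vf_app_add[OF sm(4) sm(4)]
        algebra_simps)
  have a4: "surface_connection \<phi> (\<lambda>q. f q *\<^sub>R X q) Y p = f p *\<^sub>R surface_connection \<phi> X Y p"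
    and a5: "surface_connection \<phi> X (\<lambda>q. f q *\<^sub>R Y q) p
        = f p *\<^sub>R surface_connection \<phi> X Y p + vf_app X f p *\<^sub>R Y p"
    if "smooth_on U f" "smooth_on U X" "smooth_on U Y" "p \<in> U" for f X Y p
  proof -
    show "surface_connection \<phi> (\<lambda>q. f q *\<^sub>R X q) Y p = f p *\<^sub>R surface_connection \<phi> X Y p"
      using that
      by (simp add: surface_connection_def fr_scale vf_app_field_linear[OF sm(3)]
          vf_app_field_linear[OF sm(4)] algebra_simps)
    have Y: "Y p = fr1 Y p *\<^sub>R ode_field \<phi> p + fr2 \<phi> Y p *\<^sub>R du p"
      by (simp add: fr1_def fr2_def ode_field_def dx_def du_def prod_eq_iff)
    show "surface_connection \<phi> X (\<lambda>q. f q *\<^sub>R Y q) p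
        = f p *\<^sub>R surface_connection \<phi> X Y p + vf_app X f p *\<^sub>R Y p"
      using that
      by (subst Y) (simp add: surface_connection_def fr_scale vf_app_mult[OF _ sm(3)]
          vf_app_mult[OF _ sm(4)] algebra_simps)
  qed
  have t: "surface_connection \<phi> X Y p - surface_connection \<phi> Y X p = lie_bracket X Y p"
    if "smooth_on U X" "smooth_on U Y" "p \<in> U" for X Y p
  proof -
    have *: "vf_app X (fr1 Y) p = fst (vf_app X Y p)"
      "vf_app X (fr2 \<phi> Y) p = snd (vf_app X Y p)
        - (\<phi> p * fst (vf_app X Y p) + vf_app X \<phi> p * fst (Y p))"
      if "smooth_on U X" "smooth_on U Y" for X Y
      unfolding fr1_def[abs_def] fr2_def[abs_def]
      by (simp_all add: vf_app_linear[OF bounded_linear_fst that(2) \<open>p \<in> U\<close>]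
          vf_app_linear[OF bounded_linear_snd that(2) \<open>p \<in> U\<close>]
          vf_app_mult[OF phi sm(1)[OF that(2)] \<open>p \<in> U\<close>]
          vf_app_diff[OF sm(2)[OF that(2)] smooth_on_mult[OF U phi sm(1)[OF that(2)]] \<open>p \<in> U\<close>])
    have **: "vf_app X \<phi> p = fst (X p) * vf_app dx \<phi> p + snd (X p) * vf_app du \<phi> p" for X
      using vf_app_coords[OF phi \<open>p \<in> U\<close>, of X] by (simp only: real_scaleR_def)
    show ?thesis
      unfolding prod_eq_iff surface_connection_def lie_bracket_def
        *[OF that(1,2)] *[OF that(2,1)] **[of X] **[of Y]
      by (simp add: ode_field_def dx_def du_def fr1_def fr2_def algebra_simps)
  qed
  have m: "vf_app X (\<lambda>q. surface_metric \<phi> q (Y q) (Z q)) p =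
      surface_metric \<phi> p (surface_connection \<phi> X Y p) (Z p)
      + surface_metric \<phi> p (Y p) (surface_connection \<phi> X Z p)"
    if "smooth_on U X" "smooth_on U Y" "smooth_on U Z" "p \<in> U" for X Y Z p
    using that unfolding surface_metric_frame fr1_C fr2_C
    by (simp add: vf_app_add[OF smooth_on_mult[OF U sm(3) sm(3)] smooth_on_mult[OF U sm(4) sm(4)]]
        vf_app_mult[OF sm(3) sm(3)] vf_app_mult[OF sm(4) sm(4)] algebra_simps)
  show ?thesis
    unfolding levi_civita_def affine_connection_def torsion_free_def metric_compatible_def
    by (intro conjI allI impI ballI; (rule a1 a2 a3 a4 a5 t m; assumption))
qed

end

theory Submission
  imports Defs
begin

text \<open>
  In the frame \<open>A, \<partial>\<^sub>u\<close> the field \<open>A\<close> is parallel along itself and so is \<open>\<partial>\<^sub>u\<close>; hence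
  \<open>J = \<delta>(x) \<partial>\<^sub>u\<close> satisfies \<open>\<nabla>\<^sub>A\<nabla>\<^sub>A J = \<delta>'' \<partial>\<^sub>u\<close>, and the Jacobi equation is the
  Schroedinger equation. A function \<open>\<mu>\<close> makes \<open>\<mu> (- \<phi> dx + du)\<close> closed iff
  \<open>A(\<mu>) + \<phi>\<^sub>u \<mu> = 0\<close>. For \<open>\<mu> = 1 / \<delta>\<close> this is \<open>\<SS>(\<delta>) = 0\<close>; for \<open>\<mu> = \<SS>(\<delta>)\<close> it
  follows from \<open>\<delta>'' = - \<K> \<delta>\<close> and \<open>\<K> = - (A(\<phi>\<^sub>u) + \<phi>\<^sub>u\<^sup>2)\<close>. Closed forms are locally exact.
\<close>

section \<open>Smooth functions\<close>

lemma k_smooth_on_subset: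
  "T \<subseteq> S \<Longrightarrow> k_smooth_on n S f \<Longrightarrow> k_smooth_on n T f"
  by (induction n arbitrary: f) (auto intro: continuous_on_subset)

lemma smooth_on_subset: "T \<subseteq> S \<Longrightarrow> smooth_on S f \<Longrightarrow> smooth_on T f"
  unfolding smooth_on_def using k_smooth_on_subset by blast

lemma smooth_on_imp_continuous_on: "smooth_on S f \<Longrightarrow> continuous_on S f"
  unfolding smooth_on_def by (metis k_smooth_on.simps(1))

text \<open>Smoothness of order \<open>Suc n\<close> is by definition order \<open>n\<close> for all
  directional derivatives, and every order lies below some \<open>Suc n\<close>. This makes a
  potential smooth as soon as the coefficients of its differential are.\<close>

lemma smooth_on_if_smooth_derivative:
  assumes "open S"
    and deriv: "\<And>x. x \<in> S \<Longrightarrow> (f has_derivative f' x) (at x)"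
    and smooth: "\<And>v. smooth_on S (\<lambda>x. f' x v)"
  shows "smooth_on S f"
proof -
  have eq: "f' x v = frechet_derivative f (at x) v" if "x \<in> S" for x v
    by (rule fun_cong[OF frechet_derivative_at[OF deriv[OF that]]])
  have "k_smooth_on (Suc n) S f" for n
  proof -
    have "k_smooth_on n S (\<lambda>x. f' x v)" for v
      using smooth unfolding smooth_on_def by blast
    then have "k_smooth_on n S (\<lambda>x. frechet_derivative f (at x) v)" for v
      by (rule k_smooth_on_cong[OF assms(1) eq, rotated])
    then show ?thesis using differentiableI[OF deriv] by simp
  qed
  then show ?thesis
    unfolding smooth_on_def using k_smooth_on_SucD by blast
qed

text \<open>For linear \<open>h\<close> the derivative of \<open>f \<circ> h\<close> in direction
  \<open>v\<close> is the derivative of \<open>f\<close> in the fixed direction \<open>h v\<close>,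
  again composed with \<open>h\<close>, so the induction closes. With \<open>h = fst\<close> this
  lifts functions of \<open>x\<close> alone to \<open>U\<close>.\<close>

lemma k_smooth_on_compose_linear:
  assumes h: "bounded_linear h" and "open S" and "k_smooth_on n (h ` S) f"
  shows "k_smooth_on n S (\<lambda>x. f (h x))"
  using assms(3)
proof (induction n arbitrary: f)
  case 0
  then show ?case
    using continuous_on_compose2[OF _ linear_continuous_on[OF h], of "h ` S" f S] by simp
next
  case (Suc n)
  have d: "((\<lambda>x. f (h x)) has_derivative (\<lambda>v. frechet_derivative f (at (h x)) (h v))) (at x)"
    if "x \<in> S" for x
    by (rule has_derivative_compose[OF bounded_linear_imp_has_derivative[OF h]])
       (use Suc.prems that in \<open>simp add: frechet_derivative_works\<close>)
  have e: "frechet_derivative f (at (h x)) (h v) = frechet_derivative (\<lambda>x. f (h x)) (at x) v"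
    if "x \<in> S" for x v
    by (rule fun_cong[OF frechet_derivative_at[OF d[OF that]]])
  have "k_smooth_on n S (\<lambda>x. frechet_derivative (\<lambda>x. f (h x)) (at x) v)" for v
    by (rule k_smooth_on_cong[OF assms(2) e], assumption,
        rule Suc.IH[of "\<lambda>y. frechet_derivative f (at y) (h v)"]) (use Suc.prems in simp)
  moreover have "\<forall>x\<in>S. (\<lambda>x. f (h x)) differentiable (at x)"
    using d differentiableI by blast
  ultimately show ?case by simp
qed

lemma smooth_on_compose_linear:
  "bounded_linear h \<Longrightarrow> open S \<Longrightarrow> smooth_on (h ` S) f \<Longrightarrow> smooth_on S (\<lambda>x. f (h x))"
  by (simp add: smooth_on_def k_smooth_on_compose_linear)

text \<open>The derivative of \<open>1 / f\<close> is a product of \<open>1 / f\<close>, a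
  derivative of \<open>f\<close> and \<open>1 / f\<close>; hence order \<open>n\<close> of
  \<open>1 / f\<close> yields order \<open>n + 1\<close>, with \<open>f\<close> fixed throughout the
  induction.\<close>

lemma smooth_on_inverse:
  fixes f :: "'a::real_normed_vector \<Rightarrow> real"
  assumes S: "open S" and f: "smooth_on S f" and nz: "\<And>x. x \<in> S \<Longrightarrow> f x \<noteq> 0"
  shows "smooth_on S (\<lambda>x. inverse (f x))"
proof -
  have d: "((\<lambda>x. inverse (f x)) has_derivative
      (\<lambda>v. - (inverse (f x) * frechet_derivative f (at x) v * inverse (f x)))) (at x)"
    if "x \<in> S" for x
    using Deriv.has_derivative_inverse[OF nz[OF that] smooth_on_has_derivative[OF f that]] .
  have e: "- (inverse (f x) * frechet_derivative f (at x) v * inverse (f x))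
      = frechet_derivative (\<lambda>x. inverse (f x)) (at x) v" if "x \<in> S" for x v
    by (rule fun_cong[OF frechet_derivative_at[OF d[OF that]]])
  have mult: "k_smooth_on n S (\<lambda>x. g x * h x)" if "k_smooth_on n S g" "k_smooth_on n S h"
    for n and g h :: "'a \<Rightarrow> real"
    by (rule bounded_bilinear.k_smooth_on_prod[OF bounded_bilinear_mult S that])
  have "k_smooth_on n S (\<lambda>x. inverse (f x))" for n
  proof (induction n)
    case 0
    then show ?case
      using smooth_on_imp_continuous_on[OF f] nz by (auto intro!: continuous_on_inverse)
  next
    case (Suc n)
    have f': "k_smooth_on n S (\<lambda>x. frechet_derivative f (at x) v)" for v
      using smooth_on_deriv[OF f, of v] unfolding smooth_on_def by blast
    have "k_smooth_on n S (\<lambda>x. frechet_derivative (\<lambda>x. inverse (f x)) (at x) v)" for v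
      by (rule k_smooth_on_cong[OF S e], assumption,
          rule k_smooth_on_linear[OF bounded_linear_minus[OF bounded_linear_ident] S])
         (intro mult Suc f')
    then show ?case using differentiableI[OF d] by simp
  qed
  then show ?thesis unfolding smooth_on_def by blast
qed

section \<open>Functions of one real variable and the action of vector fields\<close>

lemma smooth_on_DERIV_deriv:
  fixes f :: "real \<Rightarrow> real"
  assumes "smooth_on S f" "x \<in> S"
  shows "(f has_field_derivative deriv f x) (at x)" "frechet_derivative f (at x) 1 = deriv f x"
proof -
  have "f field_differentiable (at x)"
    using smooth_on_has_derivative[OF assms] field_differentiable_def differentiableI
    by (metis real_differentiable_def)
  then show d: "(f has_field_derivative deriv f x) (at x)"
    using DERIV_deriv_iff_field_differentiable by blast
  show "frechet_derivative f (at x) 1 = deriv f x"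
    using frechet_derivative_at[OF d[unfolded has_field_derivative_def]] by (metis mult.right_neutral)
qed

lemma smooth_on_real_deriv:
  fixes f :: "real \<Rightarrow> real"
  assumes "open S" "smooth_on S f"
  shows "smooth_on S (deriv f)"
  by (rule smooth_on_cong[OF assms(1) _ smooth_on_deriv[OF assms(2)]])
     (rule smooth_on_DERIV_deriv(2)[OF assms(2)])

lemma vf_app_fst:
  fixes f :: "real \<Rightarrow> real"
  assumes "smooth_on (fst ` U) f" "p \<in> U"
  shows "vf_app X (\<lambda>q. f (fst q)) p = deriv f (fst p) * fst (X p)"
proof -
  have "(f has_derivative (*) (deriv f (fst p))) (at (fst p))"
    using smooth_on_DERIV_deriv(1)[OF assms(1)] assms(2) by (simp add: has_field_derivative_def)
  then have "((\<lambda>q. f (fst q)) has_derivative (\<lambda>v. deriv f (fst p) * fst v)) (at p)"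
    by (rule has_derivative_compose[OF has_derivative_fst[OF has_derivative_ident]])
  then show ?thesis by (rule vf_app_eqI)
qed

lemma vf_app_const: "vf_app X (\<lambda>q. c) = (\<lambda>p. 0)"
  by (rule ext) (simp add: vf_app_eqI[OF has_derivative_const])

text \<open>A derivative at \<open>p\<close> depends only on the germ at \<open>p\<close>.
  Identities between total functions known only on \<open>U\<close> can therefore be differentiated
  there.\<close>

lemma vf_app_cong:
  assumes "open U" "\<And>q. q \<in> U \<Longrightarrow> f q = g q" "smooth_on U f" "p \<in> U"
  shows "vf_app X f p = vf_app X g p"
proof -
  have "(g has_derivative frechet_derivative f (at p)) (at p)"
    by (rule has_derivative_transform_within_open[OF smooth_on_has_derivative[OF assms(3,4)] assms(1,4)])
       (rule assms(2))
  then show ?thesis by (simp add: vf_app_eqI) (simp add: vf_app_def)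
qed

section \<open>The Levi-Civita connection of the surface\<close>

lemma levi_civita_surface_unique:
  assumes D: "levi_civita U (surface_metric \<phi>) D" and E: "levi_civita U (surface_metric \<phi>) E"
    and U: "open U"
    and X: "smooth_on U X" and Y: "smooth_on U Y" and p: "p \<in> U"
  shows "D X Y p = E X Y p"
proof -
  \<comment> \<open>\<open>g(T(X,Y),Z)\<close> is symmetric in \<open>X, Y\<close> (torsion) and skew in \<open>Y, Z\<close> (metric), hence zero.\<close>
  define T where "T X Y q = D X Y q - E X Y q" for X Y q
  have D_smooth: "smooth_on U (D X Y)" if "smooth_on U X" "smooth_on U Y" for X Y
    using D that unfolding levi_civita_def affine_connection_def by blast
  have E_smooth: "smooth_on U (E X Y)" if "smooth_on U X" "smooth_on U Y" for X Y
    using E that unfolding levi_civita_def affine_connection_def by blast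
  have T_smooth: "smooth_on U (T X Y)" if "smooth_on U X" "smooth_on U Y" for X Y
    unfolding T_def[abs_def] by (intro smooth_on_diff U D_smooth E_smooth that)
  have T_sym: "T X Y p = T Y X p" if "smooth_on U X" "smooth_on U Y" for X Y
  proof -
    have "D X Y p - D Y X p = lie_bracket X Y p" "E X Y p - E Y X p = lie_bracket X Y p"
      using D E that p unfolding levi_civita_def torsion_free_def by blast+
    then show ?thesis unfolding T_def by (simp add: algebra_simps)
  qed
  let ?g = "surface_metric \<phi> p"
  have T_skew: "?g (T X Y p) (Z p) = - ?g (T X Z p) (Y p)"
    if "smooth_on U X" "smooth_on U Y" "smooth_on U Z" for X Y Z
  proof -
    have "vf_app X (\<lambda>q. surface_metric \<phi> q (Y q) (Z q)) p = ?g (D X Y p) (Z p) + ?g (Y p) (D X Z p)"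
      "vf_app X (\<lambda>q. surface_metric \<phi> q (Y q) (Z q)) p = ?g (E X Y p) (Z p) + ?g (Y p) (E X Z p)"
      using D E that p unfolding levi_civita_def metric_compatible_def by blast+
    then show ?thesis unfolding T_def by (simp add: surface_metric_def algebra_simps)
  qed
  have "?g (T X Y p) (Z p) = 0" if Z: "smooth_on U Z" for Z
  proof -
    have "?g (T X Y p) (Z p) = - ?g (T Z X p) (Y p)"
      using T_skew[OF X Y Z] T_sym[OF X Z] by simp
    also have "\<dots> = ?g (T Y Z p) (X p)"
      using T_skew[OF Z X Y] T_sym[OF Y Z] by simp
    also have "\<dots> = - ?g (T X Y p) (Z p)"
      using T_skew[OF Y Z X] T_sym[OF X Y] by simp
    finally show ?thesis by simp
  qed
  \<comment> \<open>The choice \<open>Z = T X Y\<close> makes the vanishing inner product a squared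
    length, which is a sum of two squares in the frame coordinates.\<close>
  from this[OF T_smooth[OF X Y]]
  have "(fst (T X Y p))\<^sup>2 + (snd (T X Y p) - \<phi> p * fst (T X Y p))\<^sup>2 = 0"
    by (simp add: surface_metric_def algebra_simps power2_eq_square)
  then have "T X Y p = 0"
    by (simp add: sum_power2_eq_zero_iff prod_eq_iff)
  then show ?thesis unfolding T_def by simp
qed

text \<open>Locality of the connection in its second argument: that argument enters only through its
  value and first derivatives at \<open>p\<close>.\<close>

lemma surface_connection_cong:
  assumes U: "open U" "smooth_on U \<phi>" and p: "p \<in> U"
    and Y: "smooth_on U Y" "\<And>q. q \<in> U \<Longrightarrow> Y q = Z q"
  shows "surface_connection \<phi> X Y p = surface_connection \<phi> X Z p"
proof -
  have "vf_app X (fr1 Y) p = vf_app X (fr1 Z) p" "vf_app X (fr2 \<phi> Y) p = vf_app X (fr2 \<phi> Z) p"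
    by (rule vf_app_cong[OF U(1) _ smooth_on_fr(3)[OF U Y(1)] p], simp add: fr1_def Y)
       (rule vf_app_cong[OF U(1) _ smooth_on_fr(4)[OF U Y(1)] p], simp add: fr2_def Y)
  then show ?thesis by (simp add: surface_connection_def fr1_def fr2_def Y p)
qed

section \<open>Gaussian curvature and Jacobi fields of the surface\<close>

locale surface =
  fixes U :: "plane set" and \<phi> :: "plane \<Rightarrow> real" and D :: connection
  assumes U: "open U" and phi: "smooth_on U \<phi>" and D: "levi_civita U (surface_metric \<phi>) D"
begin

lemma D_eq: "smooth_on U X \<Longrightarrow> smooth_on U Y \<Longrightarrow> p \<in> U \<Longrightarrow> D X Y p = surface_connection \<phi> X Y p"
  using levi_civita_surface_unique[OF D surface_connection_levi_civita[OF U phi] U] by blast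

lemma D_smooth: "smooth_on U X \<Longrightarrow> smooth_on U Y \<Longrightarrow> smooth_on U (D X Y)"
  using D unfolding levi_civita_def affine_connection_def by blast

text \<open>The inner derivative agrees with the explicit formula only on \<open>U\<close>; locality
  allows the replacement inside the outer one.\<close>

lemma D_D_eq:
  assumes "smooth_on U W" "smooth_on U X" "smooth_on U Y" "p \<in> U"
    and "\<And>q. q \<in> U \<Longrightarrow> surface_connection \<phi> X Y q = Z q"
  shows "D W (D X Y) p = surface_connection \<phi> W Z p"
  using surface_connection_cong[OF U phi assms(4) D_smooth[OF assms(2,3)], of Z W]
    D_eq assms D_smooth by simp

text \<open>The right-hand side is the expanded form of
  \<open>- \<partial>\<^sub>u(A(\<phi>))\<close>, because \<open>\<partial>\<^sub>u(A(\<phi>)) =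
  A(\<phi>\<^sub>u) + \<phi>\<^sub>u\<^sup>2\<close>.\<close>

lemma gaussian_curvature_surface:
  assumes p: "p \<in> U"
  shows "gaussian_curvature (surface_metric \<phi>) D p
    = - (vf_app (ode_field \<phi>) (vf_app du \<phi>) p + (vf_app du \<phi> p)\<^sup>2)"
proof -
  note fr = smooth_on_frame[OF U phi]
  have du_phi: "smooth_on U (vf_app du \<phi>)"
    by (rule smooth_on_vf_app[OF U fr(2) phi])
  have frame [simp]: "fr1 du = (\<lambda>q. 0)" "fr2 \<phi> du = (\<lambda>q. 1)" "fr1 dx = (\<lambda>q. 1)" "fr2 \<phi> dx = (\<lambda>q. - \<phi> q)"
    by (auto simp: fr1_def fr2_def dx_def du_def)
  \<comment> \<open>Both first derivatives of \<open>\<partial>\<^sub>u\<close> along the coordinate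
    fields are multiples of \<open>A\<close>, so this one formula yields both second derivatives in
    the curvature.\<close>
  have along_A: "surface_connection \<phi> X (\<lambda>q. f q *\<^sub>R ode_field \<phi> q) p
      = vf_app X f p *\<^sub>R ode_field \<phi> p + (vf_app du \<phi> p * fr2 \<phi> X p * f p) *\<^sub>R du p" for X f
  proof -
    have "fr1 (\<lambda>q. f q *\<^sub>R ode_field \<phi> q) = f" "fr2 \<phi> (\<lambda>q. f q *\<^sub>R ode_field \<phi> q) = (\<lambda>q. 0)"
      by (auto simp: fr1_def fr2_def ode_field_def dx_def du_def)
    then show ?thesis by (simp add: surface_connection_def vf_app_const)
  qed
  have du_du: "surface_connection \<phi> du du q = - vf_app du \<phi> q *\<^sub>R ode_field \<phi> q"
    and dx_du: "surface_connection \<phi> dx du q = (\<phi> q * vf_app du \<phi> q) *\<^sub>R ode_field \<phi> q" for q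
    by (simp_all add: surface_connection_def vf_app_const)
  have "D dx (D du du) p
      = - vf_app dx (vf_app du \<phi>) p *\<^sub>R ode_field \<phi> p + (\<phi> p * (vf_app du \<phi> p)\<^sup>2) *\<^sub>R du p"
    using vf_app_linear[OF bounded_linear_minus[OF bounded_linear_ident] du_phi p, of dx]
    unfolding D_D_eq[OF fr(1,2,2) p du_du] along_A by (simp add: power2_eq_square)
  moreover have "D du (D dx du) p
      = (\<phi> p * vf_app du (vf_app du \<phi>) p + (vf_app du \<phi> p)\<^sup>2) *\<^sub>R ode_field \<phi> p
        + (\<phi> p * (vf_app du \<phi> p)\<^sup>2) *\<^sub>R du p"
    using vf_app_mult[OF phi du_phi p, of du]
    unfolding D_D_eq[OF fr(2,1,2) p dx_du] along_A by (simp add: power2_eq_square)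
  moreover have "lie_bracket dx du = (\<lambda>q. 0)"
    by (rule ext) (simp add: lie_bracket_def dx_def[abs_def] du_def[abs_def] vf_app_const)
  then have "D (lie_bracket dx du) du p = 0"
    by (simp add: D_eq[OF smooth_on_const fr(2) p] surface_connection_def vf_app_const fr2_def)
  moreover have "vf_app (ode_field \<phi>) (vf_app du \<phi>) p
      = vf_app dx (vf_app du \<phi>) p + \<phi> p * vf_app du (vf_app du \<phi>) p"
    using vf_app_coords[OF du_phi p, of "ode_field \<phi>"] by (simp add: ode_field_def dx_def du_def)
  ultimately have "curvature D dx du du p
      = - (vf_app (ode_field \<phi>) (vf_app du \<phi>) p + (vf_app du \<phi> p)\<^sup>2) *\<^sub>R ode_field \<phi> p"
    by (simp add: curvature_def algebra_simps)
  \<comment> \<open>The \<open>\<partial>\<^sub>u\<close> parts have cancelled. Since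
    \<open>g(A, \<partial>\<^sub>x) = 1\<close> and \<open>det g = 1\<close>, the coefficient of
    \<open>A\<close> is the curvature.\<close>
  then show ?thesis
    by (simp add: gaussian_curvature_def surface_metric_def ode_field_def dx_def du_def
        power2_eq_square algebra_simps)
qed

text \<open>As \<open>g(A, A) = 1\<close> and \<open>g(J, A) = 0\<close>, the Jacobi expression is
  \<open>(\<delta>'' + \<K> \<delta>) \<partial>\<^sub>u\<close>.\<close>

lemma jacobi_field_x_du:
  assumes I: "open (fst ` U)" and \<delta>: "smooth_on (fst ` U) \<delta>"
    and ode: "\<And>p. p \<in> U \<Longrightarrow>
      deriv (deriv \<delta>) (fst p) + gaussian_curvature (surface_metric \<phi>) D p * \<delta> (fst p) = 0"
  shows "jacobi_field U (surface_metric \<phi>) D (ode_field \<phi>) (\<lambda>p. \<delta> (fst p) *\<^sub>R du p)"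
  unfolding jacobi_field_def
proof (intro conjI ballI)
  note fr = smooth_on_frame[OF U phi]
  show J: "smooth_on U (\<lambda>p. \<delta> (fst p) *\<^sub>R du p)"
    by (intro smooth_on_scaleR U fr smooth_on_compose_linear[OF bounded_linear_fst] \<delta>)
  fix p assume p: "p \<in> U"
  \<comment> \<open>The connection terms vanish because \<open>A\<close> has no
    \<open>\<partial>\<^sub>u\<close> component in the frame. The formula serves twice, for
    \<open>\<delta>\<close> and for its derivative.\<close>
  have along: "surface_connection \<phi> (ode_field \<phi>) (\<lambda>p. f (fst p) *\<^sub>R du p) q = deriv f (fst q) *\<^sub>R du q"
    if "smooth_on (fst ` U) f" "q \<in> U" for f q
    using vf_app_fst[OF that, of "ode_field \<phi>"]
    by (simp add: surface_connection_def fr1_def[abs_def] fr2_def[abs_def] ode_field_def dx_def du_def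
        vf_app_const)
  have "D (ode_field \<phi>) (D (ode_field \<phi>) (\<lambda>p. \<delta> (fst p) *\<^sub>R du p)) p = deriv (deriv \<delta>) (fst p) *\<^sub>R du p"
    by (subst D_D_eq[OF fr(3) fr(3) J p along[OF \<delta>]], assumption)
       (rule along[OF smooth_on_real_deriv[OF I \<delta>] p])
  moreover have "deriv (deriv \<delta>) (fst p) = - gaussian_curvature (surface_metric \<phi>) D p * \<delta> (fst p)"
    using ode[OF p] by simp
  ultimately show "D (ode_field \<phi>) (D (ode_field \<phi>) (\<lambda>p. \<delta> (fst p) *\<^sub>R du p)) p +
      gaussian_curvature (surface_metric \<phi>) D p *\<^sub>R
        (surface_metric \<phi> p (ode_field \<phi> p) (ode_field \<phi> p) *\<^sub>R (\<delta> (fst p) *\<^sub>R du p)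
          - surface_metric \<phi> p (\<delta> (fst p) *\<^sub>R du p) (ode_field \<phi> p) *\<^sub>R ode_field \<phi> p) = 0"
    by (simp add: surface_metric_def ode_field_def dx_def du_def power2_eq_square
        algebra_simps zero_prod_def)
qed

end

section \<open>Integrating factors\<close>

lemma has_real_derivative_slices:
  fixes f :: "plane \<Rightarrow> real"
  assumes "smooth_on U f" "(x, y) \<in> U"
  shows "((\<lambda>x. f (x, y)) has_real_derivative vf_app dx f (x, y)) (at x)"
    and "((\<lambda>y. f (x, y)) has_real_derivative vf_app du f (x, y)) (at y)"
proof -
  have lin: "linear (frechet_derivative f (at (x, y)))"
    using has_derivative_linear[OF smooth_on_has_derivative[OF assms]] .
  have "frechet_derivative f (at (x, y)) (h, 0) = vf_app dx f (x, y) * h"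
    "frechet_derivative f (at (x, y)) (0, h) = vf_app du f (x, y) * h" for h
    using linear_scale[OF lin, of h "(1, 0)"] linear_scale[OF lin, of h "(0, 1)"]
    by (simp_all add: vf_app_def dx_def du_def)
  moreover have "((\<lambda>x. f (x, y)) has_derivative (\<lambda>h. frechet_derivative f (at (x, y)) (h, 0))) (at x)"
    "((\<lambda>y. f (x, y)) has_derivative (\<lambda>h. frechet_derivative f (at (x, y)) (0, h))) (at y)"
    by (rule has_derivative_compose[where f = "\<lambda>x. (x, y)", OF _ smooth_on_has_derivative[OF assms]]
          has_derivative_compose[where f = "\<lambda>y. (x, y)", OF _ smooth_on_has_derivative[OF assms]],
        auto intro!: derivative_eq_intros)+
  ultimately show "((\<lambda>x. f (x, y)) has_real_derivative vf_app dx f (x, y)) (at x)"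
    and "((\<lambda>y. f (x, y)) has_real_derivative vf_app du f (x, y)) (at y)"
    by (simp_all add: has_field_derivative_def)
qed

text \<open>The Poincare lemma on a rectangle. The potential integrates the form along the bottom
  edge from \<open>(a, c)\<close> to \<open>(x, c)\<close> and then vertically up to
  \<open>(x, y)\<close>.\<close>

lemma closed_form_exact_on_box:
  fixes P Q :: "plane \<Rightarrow> real"
  assumes W: "open W" "{a..b} \<times> {c..d} \<subseteq> W"
    and P: "smooth_on W P" and Q: "smooth_on W Q"
    and closed: "\<And>p. p \<in> W \<Longrightarrow> vf_app du P p = vf_app dx Q p"
  obtains F where "smooth_on ({a<..<b} \<times> {c<..<d}) F"
    and "\<And>p. p \<in> {a<..<b} \<times> {c<..<d} \<Longrightarrow>
      (F has_derivative (\<lambda>v. P p * fst v + Q p * snd v)) (at p)"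
proof -
  have cont: "continuous_on ({a..b} \<times> {c..d}) P" "continuous_on ({a..b} \<times> {c..d}) Q"
    "continuous_on ({a..b} \<times> {c..d}) (vf_app dx Q)" "continuous_on ({a..b} \<times> {c..d}) (vf_app du P)"
    by (rule continuous_on_subset[OF _ W(2)],
        intro smooth_on_imp_continuous_on smooth_on_vf_app P Q W(1) smooth_on_frame[OF W(1) P])+
  have cont2: "continuous_on A (\<lambda>y. f (x, y))"
    if "continuous_on ({a..b} \<times> {c..d}) f" "x \<in> {a..b}" "A \<subseteq> {c..d}" for f :: "plane \<Rightarrow> real" and x A
    by (rule continuous_on_compose2[OF that(1)]) (use that in \<open>auto intro!: continuous_intros\<close>)
  \<comment> \<open>Integrating from the corner keeps all integrals over \<open>{a..x}\<close> and \<open>{c..y}\<close> unoriented.\<close>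
  define F where "F x y = integral {a..x} (\<lambda>t. P (t, c)) + integral {c..y} (\<lambda>s. Q (x, s))" for x y
  have dF: "((\<lambda>(x, y). F x y) has_derivative (\<lambda>v. P p * fst v + Q p * snd v)) (at p)"
    if "p \<in> {a<..<b} \<times> {c<..<d}" for p
  proof -
    obtain x y where p: "p = (x, y)" by (cases p)
    have x: "x \<in> {a..b}" "c \<le> d" and y: "y \<in> {c..d}" using that p by auto
    \<comment> \<open>Closedness turns the \<open>x\<close>-derivative of \<open>Q\<close> into the
      \<open>u\<close>-derivative of \<open>P\<close>, whose integral along the vertical segment
      telescopes.\<close>
    have Qx: "integral {c..y} (\<lambda>s. vf_app dx Q (x, s)) = P (x, y) - P (x, c)"
    proof (rule integral_unique, rule fundamental_theorem_of_calculus)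
      fix s assume s: "s \<in> {c..y}"
      then have "(x, s) \<in> W" using W(2) x y by auto
      then have "((\<lambda>s. P (x, s)) has_real_derivative vf_app dx Q (x, s)) (at s)"
        using has_real_derivative_slices(2)[OF P] closed by metis
      then show "((\<lambda>s. P (x, s)) has_vector_derivative vf_app dx Q (x, s)) (at s within {c..y})"
        by (simp add: has_real_derivative_iff_has_vector_derivative has_vector_derivative_at_within)
    qed (use y in simp)
    \<comment> \<open>Differentiation under the integral sign; the boundary term
      \<open>- P (x, c)\<close> in \<open>Qx\<close> then cancels against the derivative of the
      bottom-edge integral.\<close>
    have "((\<lambda>x. integral (cbox c y) (\<lambda>s. Q (x, s))) has_real_derivative
        integral (cbox c y) (\<lambda>s. vf_app dx Q (x, s))) (at x within {a..b})"
    proof (rule leibniz_rule_field_derivative)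
      show "((\<lambda>x. Q (x, s)) has_real_derivative vf_app dx Q (x, s)) (at x within {a..b})"
        if "x \<in> {a..b}" "s \<in> cbox c y" for x s
      proof -
        have "(x, s) \<in> W" using W(2) that y by auto
        from has_real_derivative_slices(1)[OF Q this] show ?thesis
          by (rule has_field_derivative_at_within)
      qed
      show "(\<lambda>s. Q (x, s)) integrable_on cbox c y" if "x \<in> {a..b}" for x
        by (rule integrable_continuous, rule cont2[OF cont(2) that]) (use y in auto)
      show "continuous_on ({a..b} \<times> cbox c y) (\<lambda>(x, s). vf_app dx Q (x, s))"
        by (simp, rule continuous_on_subset[OF cont(3)]) (use y in auto)
    qed (use x in auto)
    moreover have "((\<lambda>x. integral {a..x} (\<lambda>t. P (t, c))) has_real_derivative P (x, c)) (at x within {a..b})"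
      by (rule integral_has_real_derivative, rule continuous_on_compose2[OF cont(1)])
         (use x in \<open>auto intro!: continuous_intros\<close>)
    ultimately have "((\<lambda>x. F x y) has_real_derivative P (x, y)) (at x within {a..b})"
      using DERIV_add Qx unfolding F_def by fastforce
    then have Fx: "((\<lambda>x. F x y) has_derivative (*) (P (x, y))) (at x within {a..b})"
      by (simp add: has_field_derivative_def)
    \<comment> \<open>Total differentiability at \<open>p\<close> follows from the
      \<open>x\<close>-partial at \<open>p\<close> alone together with a \<open>u\<close>-partial
      that exists on the whole box and is continuous at \<open>p\<close>; hence the wider range of
      \<open>x\<close> and \<open>y\<close> here.\<close>
    have Fy: "((\<lambda>y. F x y) has_derivative blinfun_apply (blinfun_mult_right (Q (x, y)))) (at y within {c..d})"
      if "x \<in> {a..b}" "y \<in> {c..d}" for x y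
      unfolding F_def
      using integral_has_real_derivative[OF cont2[OF cont(2) that(1) order_refl] that(2)]
      by (intro has_derivative_eq_rhs[OF has_derivative_add[OF has_derivative_const]])
         (auto simp: has_field_derivative_def)
    have "continuous (at (x, y) within {a..b} \<times> {c..d}) (\<lambda>(x, y). blinfun_mult_right (Q (x, y)))"
      using bounded_linear.continuous[OF bounded_linear_blinfun_mult_right, of "at (x, y) within {a..b} \<times> {c..d}" Q]
        cont(2) x(1) y by (simp add: continuous_on_eq_continuous_within split_beta')
    from has_derivative_partialsI[OF Fx Fy this y convex_closed_interval]
    have "((\<lambda>(x, y). F x y) has_derivative (\<lambda>v. P p * fst v + Q p * snd v))
        (at p within {a..b} \<times> {c..d})"
      by (simp add: p split_beta')
    \<comment> \<open>At an interior point the derivative within the closed box is the full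
      derivative.\<close>
    moreover have "p \<in> interior ({a..b} \<times> {c..d})"
      using that by (simp only: interior_Times interior_atLeastAtMost_real)
    ultimately show ?thesis by (simp only: at_within_interior)
  qed
  have sub: "{a<..<b} \<times> {c<..<d} \<subseteq> W" using W(2) by force
  have "smooth_on ({a<..<b} \<times> {c<..<d}) (\<lambda>(x, y). F x y)"
    by (rule smooth_on_if_smooth_derivative[OF _ dF])
       (intro smooth_on_add smooth_on_mult smooth_on_const smooth_on_subset[OF sub P]
         smooth_on_subset[OF sub Q] open_Times open_greaterThanLessThan | assumption)+
  then show ?thesis using dF that by blast
qed

text \<open>The form is \<open>P dx + \<mu> du\<close> with \<open>P = - \<phi> \<mu>\<close>. Its
  closedness, \<open>P\<^sub>u = \<mu>\<^sub>x\<close>, unfolds to the equation assumed for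
  \<open>A(\<mu>)\<close>, and a small box around \<open>p\<close> supplies the potential.\<close>

lemma integrating_factor_near:
  assumes W: "open W" "p \<in> W" and phi: "smooth_on W \<phi>"
    and \<mu>: "smooth_on W \<mu>" "\<And>q. q \<in> W \<Longrightarrow> \<mu> q \<noteq> 0"
    and eq: "\<And>q. q \<in> W \<Longrightarrow> vf_app (ode_field \<phi>) \<mu> q = - vf_app du \<phi> q * \<mu> q"
  shows "\<exists>V. open V \<and> p \<in> V \<and> V \<subseteq> W \<and> integrating_factor \<phi> V \<mu>"
proof -
  obtain a b where ab: "cbox a b \<subseteq> W" "p \<in> box a b"
    by (rule open_contains_cbox[OF W])
  define P where "P q = - (\<phi> q * \<mu> q)" for q
  have phi_mu: "smooth_on W (\<lambda>q. \<phi> q * \<mu> q)"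
    by (intro smooth_on_mult W phi \<mu>)
  have P: "smooth_on W P"
    unfolding P_def[abs_def]
    by (rule smooth_on_linear[OF bounded_linear_minus[OF bounded_linear_ident] W(1) phi_mu])
  have closed: "vf_app du P q = vf_app dx \<mu> q" if q: "q \<in> W" for q
  proof -
    have "vf_app du P q = - (\<phi> q * vf_app du \<mu> q + vf_app du \<phi> q * \<mu> q)"
      unfolding P_def[abs_def]
      using vf_app_linear[OF bounded_linear_minus[OF bounded_linear_ident] phi_mu q]
        vf_app_mult[OF phi \<mu>(1) q] by simp
    moreover have "vf_app (ode_field \<phi>) \<mu> q = vf_app dx \<mu> q + \<phi> q * vf_app du \<mu> q"
      using vf_app_coords[OF \<mu>(1) q, of "ode_field \<phi>"] by (simp add: ode_field_def dx_def du_def)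
    ultimately show ?thesis using eq[OF q] by simp
  qed
  let ?V = "{fst a<..<fst b} \<times> {snd a<..<snd b}"
  have box: "{fst a..fst b} \<times> {snd a..snd b} \<subseteq> W"
    using ab(1) by (cases a; cases b) (simp add: cbox_Pair_eq)
  from closed_form_exact_on_box[OF W(1) this P \<mu>(1) closed]
  obtain F where F: "smooth_on ?V F"
    "\<And>q. q \<in> ?V \<Longrightarrow> (F has_derivative (\<lambda>v. P q * fst v + \<mu> q * snd v)) (at q)"
    by blast
  have "?V \<subseteq> {fst a..fst b} \<times> {snd a..snd b}"
    by (intro Sigma_mono) auto
  then have V: "open ?V" "p \<in> ?V" "?V \<subseteq> W"
    using ab(2) box
    by (simp_all add: open_Times mem_box Basis_prod_def mem_Times_iff ball_Un inner_prod_def)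
  have form: "(\<lambda>v. P q * fst v + \<mu> q * snd v) = (\<lambda>v. \<mu> q * (- \<phi> q * fst v + snd v))" for q
    by (auto simp: P_def algebra_simps)
  have "integrating_factor \<phi> ?V \<mu>"
    unfolding integrating_factor_def
  proof (intro conjI exI ballI)
    show "smooth_on ?V \<mu>" by (rule smooth_on_subset[OF V(3) \<mu>(1)])
    show "\<mu> q \<noteq> 0" if "q \<in> ?V" for q by (rule \<mu>(2)[OF subsetD[OF V(3) that]])
    show "smooth_on ?V F" by (rule F(1))
    show "(F has_derivative (\<lambda>v. \<mu> q * (- \<phi> q * fst v + snd v))) (at q)" if "q \<in> ?V" for q
      using F(2)[OF that] unfolding form .
  qed
  then show ?thesis using V by blast
qed

section \<open>From the Schroedinger-type equation to the Jacobi field and the integrating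
  factors\<close>

theorem mainTheorem3:
  fixes U :: "(real \<times> real) set"
    and \<phi> :: "real \<times> real \<Rightarrow> real"
    and k \<delta> :: "real \<Rightarrow> real"
    and D :: connection
  assumes "open U" and "connected U" and "U \<noteq> {}"
    and "smooth_on U \<phi>"
    and "levi_civita U (surface_metric \<phi>) D"
    and "smooth_on (fst ` U) k"
    and "\<forall>p\<in>U. gaussian_curvature (surface_metric \<phi>) D p = k (fst p)"
    and "smooth_on (fst ` U) \<delta>"
    and "\<exists>x\<in>fst ` U. \<delta> x \<noteq> 0"
    and "\<forall>x\<in>fst ` U. deriv (deriv \<delta>) x + k x * \<delta> x = 0"
  shows "jacobi_field U (surface_metric \<phi>) D (ode_field \<phi>) (\<lambda>p. \<delta> (fst p) *\<^sub>R du p) \<and>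
    ((\<forall>p\<in>U. frak_S \<phi> (\<lambda>q. \<delta> (fst q)) p = 0) \<longrightarrow>
       (\<forall>p\<in>U. \<delta> (fst p) \<noteq> 0 \<longrightarrow>
         (\<exists>V. open V \<and> p \<in> V \<and> V \<subseteq> U \<and>
            integrating_factor \<phi> V (\<lambda>q. inverse (\<delta> (fst q)))))) \<and>
    ((\<exists>p\<in>U. frak_S \<phi> (\<lambda>q. \<delta> (fst q)) p \<noteq> 0) \<longrightarrow>
       (\<forall>p\<in>U. frak_S \<phi> (\<lambda>q. \<delta> (fst q)) p \<noteq> 0 \<longrightarrow>
         (\<exists>V. open V \<and> p \<in> V \<and> V \<subseteq> U \<and>
            integrating_factor \<phi> V (frak_S \<phi> (\<lambda>q. \<delta> (fst q))))))"
proof -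
  interpret surface U \<phi> D
    using assms(1,4,5) by unfold_locales
  have I: "open (fst ` U)"
    by (rule open_image_fst[OF U])
  have d: "smooth_on U (\<lambda>q. \<delta> (fst q))" "smooth_on U (\<lambda>q. deriv \<delta> (fst q))"
    by (intro smooth_on_compose_linear[OF bounded_linear_fst U] smooth_on_real_deriv I assms(8))+
  have du_phi: "smooth_on U (vf_app du \<phi>)"
    by (intro smooth_on_vf_app U smooth_on_frame[OF U phi] phi)
  have schroedinger:
    "deriv (deriv \<delta>) (fst q) + gaussian_curvature (surface_metric \<phi>) D q * \<delta> (fst q) = 0" if "q \<in> U" for q
    using assms(7,10) that by simp
  have A_d: "vf_app (ode_field \<phi>) (\<lambda>q. \<delta> (fst q)) q = deriv \<delta> (fst q)"
    "vf_app (ode_field \<phi>) (\<lambda>q. deriv \<delta> (fst q)) q = deriv (deriv \<delta>) (fst q)" if "q \<in> U" for q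
    using that vf_app_fst[OF assms(8)] vf_app_fst[OF smooth_on_real_deriv[OF I assms(8)]]
    by (simp_all add: ode_field_def dx_def du_def)
  let ?S = "frak_S \<phi> (\<lambda>q. \<delta> (fst q))"
  \<comment> \<open>\<open>A(\<delta>) = \<delta>'\<close> is available on \<open>U\<close>, so the
    smoothness of \<open>?S\<close> and its derivative along \<open>A\<close> are transferred from
    this expression by congruence on \<open>U\<close>.\<close>
  have S_eq: "deriv \<delta> (fst q) - vf_app du \<phi> q * \<delta> (fst q) = ?S q" if "q \<in> U" for q
    using A_d(1)[OF that] by (simp add: frak_S_def)
  have S': "smooth_on U (\<lambda>q. deriv \<delta> (fst q) - vf_app du \<phi> q * \<delta> (fst q))"
    by (intro smooth_on_diff smooth_on_mult U d du_phi)
  have S: "smooth_on U ?S"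
    by (rule smooth_on_cong[OF U S_eq S'])
  \<comment> \<open>Common part of both cases: \<open>f\<close> is \<open>\<delta>\<close> for
    \<open>\<mu> = 1 / \<delta>\<close>, and \<open>f = \<mu>\<close> for \<open>\<mu> = ?S\<close>.
    The set where \<open>f\<close> does not vanish is open by continuity.\<close>
  have factor: "\<exists>V. open V \<and> p \<in> V \<and> V \<subseteq> U \<and> integrating_factor \<phi> V \<mu>"
    if p: "p \<in> U" "f p \<noteq> 0" and f: "smooth_on U f"
      and \<mu>: "\<And>W. open W \<Longrightarrow> W \<subseteq> U \<Longrightarrow> (\<And>q. q \<in> W \<Longrightarrow> f q \<noteq> 0) \<Longrightarrow> smooth_on W \<mu>"
        "\<And>q. q \<in> U \<Longrightarrow> f q \<noteq> 0 \<Longrightarrow> \<mu> q \<noteq> 0"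
        "\<And>q. q \<in> U \<Longrightarrow> f q \<noteq> 0 \<Longrightarrow> vf_app (ode_field \<phi>) \<mu> q = - vf_app du \<phi> q * \<mu> q"
    for p and f \<mu> :: "plane \<Rightarrow> real"
  proof -
    let ?W = "{q \<in> U. f q \<noteq> 0}"
    have W: "open ?W"
      using continuous_open_preimage[OF smooth_on_imp_continuous_on[OF f] U, of "- {0}"]
      by (simp add: Int_def vimage_def open_Compl)
    have "\<exists>V. open V \<and> p \<in> V \<and> V \<subseteq> ?W \<and> integrating_factor \<phi> V \<mu>"
      by (rule integrating_factor_near[OF W])
         (use p \<mu> W smooth_on_subset[OF _ phi] in auto)
    then show ?thesis by blast
  qed
  have "\<exists>V. open V \<and> p \<in> V \<and> V \<subseteq> U \<and> integrating_factor \<phi> V (\<lambda>q. inverse (\<delta> (fst q)))"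
    if S0: "\<forall>p\<in>U. ?S p = 0" and p: "p \<in> U" "\<delta> (fst p) \<noteq> 0" for p
  proof (rule factor[OF p d(1)])
    show "smooth_on W (\<lambda>q. inverse (\<delta> (fst q)))"
      if "open W" "W \<subseteq> U" "\<And>q. q \<in> W \<Longrightarrow> \<delta> (fst q) \<noteq> 0" for W
      by (rule smooth_on_inverse[OF that(1) smooth_on_subset[OF that(2) d(1)] that(3)])
    fix q assume q: "q \<in> U" "\<delta> (fst q) \<noteq> 0"
    then show "inverse (\<delta> (fst q)) \<noteq> 0" by simp
    have "vf_app (ode_field \<phi>) (\<lambda>q. inverse (\<delta> (fst q))) q
        = - (inverse (\<delta> (fst q)) * deriv \<delta> (fst q) * inverse (\<delta> (fst q)))"
      using vf_app_eqI[OF Deriv.has_derivative_inverse[OF q(2) smooth_on_has_derivative[OF d(1) q(1)]]]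
        A_d(1)[OF q(1)] by (simp add: vf_app_def)
    \<comment> \<open>This is \<open>?S q = 0\<close>; it turns
      \<open>- \<delta>' / \<delta>\<^sup>2\<close> into
      \<open>- \<phi>\<^sub>u / \<delta>\<close>.\<close>
    also have "deriv \<delta> (fst q) = vf_app du \<phi> q * \<delta> (fst q)"
      using S0 S_eq[OF q(1)] q(1) by simp
    finally show "vf_app (ode_field \<phi>) (\<lambda>q. inverse (\<delta> (fst q))) q
        = - vf_app du \<phi> q * inverse (\<delta> (fst q))"
      using q(2) by simp
  qed
  moreover have "\<exists>V. open V \<and> p \<in> V \<and> V \<subseteq> U \<and> integrating_factor \<phi> V ?S"
    if p: "p \<in> U" "?S p \<noteq> 0" for p
  proof (rule factor[OF p S])
    show "smooth_on W ?S" if "W \<subseteq> U" for W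
      using smooth_on_subset[OF that S] .
    fix q assume q: "q \<in> U"
    have "vf_app (ode_field \<phi>) ?S q
        = vf_app (ode_field \<phi>) (\<lambda>q. deriv \<delta> (fst q) - vf_app du \<phi> q * \<delta> (fst q)) q"
      using vf_app_cong[OF U S_eq S' q] by simp
    also have "\<dots> = deriv (deriv \<delta>) (fst q)
        - (vf_app du \<phi> q * deriv \<delta> (fst q) + vf_app (ode_field \<phi>) (vf_app du \<phi>) q * \<delta> (fst q))"
      by (simp add: vf_app_diff[OF d(2) smooth_on_mult[OF U du_phi d(1)] q]
          vf_app_mult[OF du_phi d(1) q] A_d[OF q])
    \<comment> \<open>The Schroedinger equation with the curvature formula inserted: the terms
      \<open>A(\<phi>\<^sub>u) \<delta>\<close> cancel and
      \<open>- \<phi>\<^sub>u (\<delta>' - \<phi>\<^sub>u \<delta>)\<close> remains.\<close>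
    also have "deriv (deriv \<delta>) (fst q)
        = (vf_app (ode_field \<phi>) (vf_app du \<phi>) q + (vf_app du \<phi> q)\<^sup>2) * \<delta> (fst q)"
      using schroedinger[OF q] gaussian_curvature_surface[OF q] by (simp add: algebra_simps)
    finally show "vf_app (ode_field \<phi>) ?S q = - vf_app du \<phi> q * ?S q"
      unfolding S_eq[OF q, symmetric] by (simp add: algebra_simps power2_eq_square)
  qed
  moreover have "jacobi_field U (surface_metric \<phi>) D (ode_field \<phi>) (\<lambda>p. \<delta> (fst p) *\<^sub>R du p)"
    by (rule jacobi_field_x_du[OF I assms(8) schroedinger])
  ultimately show ?thesis by blast
qed

end
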